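(* Let $S$ be an intra-regular LA-semigroup with left identity and let $A$ be a nonempty subset of $S$. Then the following conditions are equivalent: (i) $A$ is a bi-ideal of $S$; (ii) $(AS)A=A$ and $A^{2}=A$. The same equivalence holds with "bi-ideal" replaced by "generalized bi-ideal" in (i).
   Context: An LA-semigroup (left almost semigroup) is a nonempty set $S$ with a binary operation, written as juxtaposition, satisfying the left invertive law $(ab)c=(cb)a$ for all $a,b,c\in S$ (associativity and commutativity are not assumed). A left identity is an element $e\in S$ with $ea=a$ for all $a\in S$. For subsets $A,B\subseteq S$, $AB=\{ab: a\in A,\ b\in B\}$ and $A^2=AA$. A nonempty subset $A\subseteq S$ is an LA-subsemigroup if $A^2\subseteq A$; it is a generalized bi-ideal if $(AS)A\subseteq A$; and it is a bi-ideal if it is an LA-subsemigroup with $(AS)A\subseteq A$. $S$ is intra-regular if for every $a\in S$ there exist $x,y\in S$ such that $a=(xa^{2})y$, where $a^2=aa$. *)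

theory Defs
  imports Main
begin

text \<open>
  The structure is an explicit carrier \<open>S\<close> with an operation \<open>m\<close>; nothing is assumed about the
  values of \<open>m\<close> outside \<open>S\<close>. Associativity and commutativity are not assumed.
\<close>

locale la_semigroup =
  fixes S :: "'a set" and m :: "'a \<Rightarrow> 'a \<Rightarrow> 'a" (infixl "\<cdot>" 70)
  assumes nonempty: "S \<noteq> {}"
    and closed: "\<lbrakk>a \<in> S; b \<in> S\<rbrakk> \<Longrightarrow> a \<cdot> b \<in> S"
    and left_invertive: "\<lbrakk>a \<in> S; b \<in> S; c \<in> S\<rbrakk> \<Longrightarrow> (a \<cdot> b) \<cdot> c = (c \<cdot> b) \<cdot> a"

definition left_identity :: "'a set \<Rightarrow> ('a \<Rightarrow> 'a \<Rightarrow> 'a) \<Rightarrow> 'a \<Rightarrow> bool" where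
  "left_identity S m e \<longleftrightarrow> e \<in> S \<and> (\<forall>a\<in>S. m e a = a)"

definition intra_regular :: "'a set \<Rightarrow> ('a \<Rightarrow> 'a \<Rightarrow> 'a) \<Rightarrow> bool" where
  "intra_regular S m \<longleftrightarrow> (\<forall>a\<in>S. \<exists>x\<in>S. \<exists>y\<in>S. a = m (m x (m a a)) y)"

definition set_prod :: "('a \<Rightarrow> 'a \<Rightarrow> 'a) \<Rightarrow> 'a set \<Rightarrow> 'a set \<Rightarrow> 'a set" where
  "set_prod m A B = {m a b | a b. a \<in> A \<and> b \<in> B}"

definition la_subsemigroup :: "'a set \<Rightarrow> ('a \<Rightarrow> 'a \<Rightarrow> 'a) \<Rightarrow> 'a set \<Rightarrow> bool" where
  "la_subsemigroup S m A \<longleftrightarrow> A \<noteq> {} \<and> A \<subseteq> S \<and> set_prod m A A \<subseteq> A"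

definition generalized_bi_ideal :: "'a set \<Rightarrow> ('a \<Rightarrow> 'a \<Rightarrow> 'a) \<Rightarrow> 'a set \<Rightarrow> bool" where
  "generalized_bi_ideal S m A \<longleftrightarrow>
     A \<noteq> {} \<and> A \<subseteq> S \<and> set_prod m (set_prod m A S) A \<subseteq> A"

definition bi_ideal :: "'a set \<Rightarrow> ('a \<Rightarrow> 'a \<Rightarrow> 'a) \<Rightarrow> 'a set \<Rightarrow> bool" where
  "bi_ideal S m A \<longleftrightarrow> la_subsemigroup S m A \<and> set_prod m (set_prod m A S) A \<subseteq> A"

end

theory Submission
  imports Defs
begin

text \<open>
  Only one implication has content: a generalized bi-ideal \<open>A\<close> satisfies \<open>(AS)A = A\<close> and
  \<open>A\<^sup>2 = A\<close>. Everything is reduced to computations with a single element. A left identity makes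
  the operation medial and paramedial and gives \<open>a(bc) = b(ac)\<close>. With these laws
  intra-regularity \<open>a = (xa\<^sup>2)y\<close> collapses to the one-parameter form \<open>a = (ta)a\<close>
  (\<open>intra_regular_left_factor\<close>). Substituting this equation into itself lets a multiplier be
  moved from the left of \<open>a\<close> to the right: \<open>Sa \<subseteq> aS\<close> (\<open>left_multiple_is_right_multiple\<close>).

  These facts carry over to \<open>A\<close>:

  \<^item> \<open>a = (ta)a\<close> lies in \<open>(aS)a\<close>, whence \<open>A \<subseteq> (AS)A\<close>;
  \<^item> \<open>ta\<close> itself lies in \<open>(aS)a\<close>, so that \<open>a\<close> lies in \<open>((aS)a)a\<close>
    (\<open>intra_regular_iterated_factor\<close>), whence \<open>A \<subseteq> ((AS)A)A \<subseteq> A\<^sup>2\<close>;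
  \<^item> \<open>a\<close> lies in \<open>Sa\<close>, hence in \<open>aS\<close> (\<open>intra_regular_right_unit\<close>), so \<open>ab = (ar)b\<close> for some
    \<open>r\<close>, whence \<open>A\<^sup>2 \<subseteq> (AS)A \<subseteq> A\<close>.

  The last inclusion is also what makes a generalized bi-ideal a bi-ideal.
\<close>

section \<open>LA-semigroups with left identity\<close>

context la_semigroup
begin

lemma medial:
  assumes "a \<in> S" "b \<in> S" "c \<in> S" "d \<in> S"
  shows "(a \<cdot> b) \<cdot> (c \<cdot> d) = (a \<cdot> c) \<cdot> (b \<cdot> d)"
proof -
  have "(a \<cdot> b) \<cdot> (c \<cdot> d) = ((c \<cdot> d) \<cdot> b) \<cdot> a"
    using assms left_invertive[of a b "c \<cdot> d"] by (simp add: closed)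
  also have "\<dots> = ((b \<cdot> d) \<cdot> c) \<cdot> a"
    using assms left_invertive[of c d b] by simp
  also have "\<dots> = (a \<cdot> c) \<cdot> (b \<cdot> d)"
    using assms left_invertive[of "b \<cdot> d" c a] by (simp add: closed)
  finally show ?thesis .
qed

lemma left_commute:
  assumes e: "left_identity S (\<cdot>) e" and "a \<in> S" "b \<in> S" "c \<in> S"
  shows "a \<cdot> (b \<cdot> c) = b \<cdot> (a \<cdot> c)"
  using assms medial[of e a b c] unfolding left_identity_def by (simp add: closed)

lemma paramedial:
  assumes e: "left_identity S (\<cdot>) e" and "a \<in> S" "b \<in> S" "c \<in> S" "d \<in> S"
  shows "(a \<cdot> b) \<cdot> (c \<cdot> d) = (d \<cdot> b) \<cdot> (c \<cdot> a)"
proof -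
  have "(a \<cdot> b) \<cdot> (c \<cdot> d) = c \<cdot> ((a \<cdot> b) \<cdot> d)"
    using assms left_commute[OF e, of "a \<cdot> b" c d] by (simp add: closed)
  also have "\<dots> = c \<cdot> ((d \<cdot> b) \<cdot> a)"
    using assms left_invertive[of a b d] by simp
  also have "\<dots> = (d \<cdot> b) \<cdot> (c \<cdot> a)"
    using assms left_commute[OF e, of c "d \<cdot> b" a] by (simp add: closed)
  finally show ?thesis .
qed

section \<open>Factorizations of an element\<close>

text \<open>
  In \<open>(xa\<^sup>2)y\<close> the square is opened by \<open>x(aa) = a(xa)\<close>, and left invertivity exchanges the outer
  factors \<open>a\<close> and \<open>y\<close>. The remaining multiplier \<open>y(xa)\<close> is brought into the form \<open>ta\<close> by
  writing \<open>y = ey\<close>.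
\<close>

lemma intra_regular_left_factor:
  assumes e: "left_identity S (\<cdot>) e" and "intra_regular S (\<cdot>)" and a: "a \<in> S"
  obtains t where "t \<in> S" and "a = (t \<cdot> a) \<cdot> a"
proof -
  have eS: "e \<in> S" and e_left: "\<And>s. s \<in> S \<Longrightarrow> e \<cdot> s = s"
    using e by (auto simp: left_identity_def)
  obtain x y where x: "x \<in> S" and y: "y \<in> S" and "a = (x \<cdot> (a \<cdot> a)) \<cdot> y"
    using assms unfolding intra_regular_def by blast
  note this(3)
  also have "(x \<cdot> (a \<cdot> a)) \<cdot> y = (a \<cdot> (x \<cdot> a)) \<cdot> y"
    using left_commute[OF e x a a] by simp
  also have "\<dots> = (y \<cdot> (x \<cdot> a)) \<cdot> a"
    using a x y by (simp add: left_invertive closed)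
  also have "y \<cdot> (x \<cdot> a) = (e \<cdot> y) \<cdot> (x \<cdot> a)"
    using y by (simp add: e_left)
  also have "\<dots> = (a \<cdot> y) \<cdot> (x \<cdot> e)"
    using paramedial[OF e eS y x a] .
  also have "\<dots> = ((x \<cdot> e) \<cdot> y) \<cdot> a"
    using a x y eS by (simp add: left_invertive closed)
  finally show thesis
    using that[of "(x \<cdot> e) \<cdot> y"] x y eS by (simp add: closed)
qed

text \<open>
  Replacing \<open>a\<close> by \<open>(ta)a\<close> in \<open>ca\<close> creates enough copies of \<open>a\<close> for the medial law to
  produce a factor \<open>aa\<close>, from which one \<open>a\<close> can be pulled to the front.
\<close>

lemma left_multiple_is_right_multiple:
  assumes e: "left_identity S (\<cdot>) e" and ir: "intra_regular S (\<cdot>)"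
    and a: "a \<in> S" and c: "c \<in> S"
  obtains z where "z \<in> S" and "c \<cdot> a = a \<cdot> z"
proof -
  obtain t where t: "t \<in> S" and at: "a = (t \<cdot> a) \<cdot> a"
    using intra_regular_left_factor[OF e ir a] .
  have "c \<cdot> a = c \<cdot> ((t \<cdot> a) \<cdot> a)"
    using at by simp
  also have "\<dots> = (t \<cdot> a) \<cdot> (c \<cdot> a)"
    using left_commute[OF e c _ a, of "t \<cdot> a"] t a by (simp add: closed)
  also have "\<dots> = (t \<cdot> c) \<cdot> (a \<cdot> a)"
    using medial[OF t a c a] .
  also have "\<dots> = a \<cdot> ((t \<cdot> c) \<cdot> a)"
    using left_commute[OF e _ a a, of "t \<cdot> c"] t c by (simp add: closed)
  finally show thesis
    using that[of "(t \<cdot> c) \<cdot> a"] t c a by (simp add: closed)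
qed

lemma intra_regular_right_unit:
  assumes "left_identity S (\<cdot>) e" and "intra_regular S (\<cdot>)" and "a \<in> S"
  obtains r where "r \<in> S" and "a = a \<cdot> r"
proof -
  obtain t where "t \<in> S" "a = (t \<cdot> a) \<cdot> a"
    using intra_regular_left_factor[OF assms] .
  moreover obtain r where "r \<in> S" "(t \<cdot> a) \<cdot> a = a \<cdot> r"
    using left_multiple_is_right_multiple[OF assms, of "t \<cdot> a"] \<open>t \<in> S\<close> \<open>a \<in> S\<close> closed
    by blast
  ultimately show thesis
    using that by simp
qed

text \<open>
  In \<open>a = (ta)a\<close> the left factor is idempotent, because \<open>ta = t((ta)a) = (ta)(ta)\<close>; rearranged
  as \<open>((tt)a)a = (az)a\<close> it acquires the shape of an element of \<open>(AS)A\<close>, which puts it in every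
  generalized bi-ideal containing \<open>a\<close>.
\<close>

lemma intra_regular_iterated_factor:
  assumes e: "left_identity S (\<cdot>) e" and ir: "intra_regular S (\<cdot>)" and a: "a \<in> S"
  obtains z where "z \<in> S" and "a = ((a \<cdot> z) \<cdot> a) \<cdot> a"
proof -
  obtain t where t: "t \<in> S" and at: "a = (t \<cdot> a) \<cdot> a"
    using intra_regular_left_factor[OF e ir a] .
  obtain z where z: "z \<in> S" and tz: "(t \<cdot> t) \<cdot> a = a \<cdot> z"
    using left_multiple_is_right_multiple[OF e ir a, of "t \<cdot> t"] t closed by blast
  have "t \<cdot> a = t \<cdot> ((t \<cdot> a) \<cdot> a)"
    using at by simp
  also have "\<dots> = (t \<cdot> a) \<cdot> (t \<cdot> a)"
    using left_commute[OF e t _ a, of "t \<cdot> a"] t a by (simp add: closed)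
  also have "\<dots> = (a \<cdot> a) \<cdot> (t \<cdot> t)"
    using paramedial[OF e t a t a] .
  also have "\<dots> = ((t \<cdot> t) \<cdot> a) \<cdot> a"
    using t a left_invertive[of a a "t \<cdot> t"] by (simp add: closed)
  also have "\<dots> = (a \<cdot> z) \<cdot> a"
    using tz by simp
  finally have "a = ((a \<cdot> z) \<cdot> a) \<cdot> a"
    using at by simp
  with z show thesis
    using that by blast
qed

section \<open>Generalized bi-ideals\<close>

lemma subset_bi_product:
  assumes e: "left_identity S (\<cdot>) e" and ir: "intra_regular S (\<cdot>)" and "A \<subseteq> S"
  shows "A \<subseteq> set_prod (\<cdot>) (set_prod (\<cdot>) A S) A"
proof
  fix a assume "a \<in> A"
  then have a: "a \<in> S"
    using \<open>A \<subseteq> S\<close> by blast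
  obtain t where t: "t \<in> S" and at: "a = (t \<cdot> a) \<cdot> a"
    using intra_regular_left_factor[OF e ir a] .
  obtain z where "z \<in> S" "t \<cdot> a = a \<cdot> z"
    using left_multiple_is_right_multiple[OF e ir a t] .
  then have "a = (a \<cdot> z) \<cdot> a"
    using at by simp
  then show "a \<in> set_prod (\<cdot>) (set_prod (\<cdot>) A S) A"
    using \<open>a \<in> A\<close> \<open>z \<in> S\<close> unfolding set_prod_def by blast
qed

lemma generalized_bi_ideal_idempotent:
  assumes e: "left_identity S (\<cdot>) e" and ir: "intra_regular S (\<cdot>)"
    and gen: "generalized_bi_ideal S (\<cdot>) A"
  shows "set_prod (\<cdot>) A A = A"
proof
  have AS: "A \<subseteq> S"
    using gen by (simp add: generalized_bi_ideal_def)
  have bi: "(a \<cdot> s) \<cdot> b \<in> A" if "a \<in> A" "s \<in> S" "b \<in> A" for a s b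
    using gen that unfolding generalized_bi_ideal_def set_prod_def by blast
  show "set_prod (\<cdot>) A A \<subseteq> A"
  proof
    fix c assume "c \<in> set_prod (\<cdot>) A A"
    then obtain a b where ab: "a \<in> A" "b \<in> A" "c = a \<cdot> b"
      by (auto simp: set_prod_def)
    obtain r where "r \<in> S" "a = a \<cdot> r"
      using intra_regular_right_unit[OF e ir, of a] ab AS by blast
    then show "c \<in> A"
      using bi[of a r b] ab by simp
  qed
  show "A \<subseteq> set_prod (\<cdot>) A A"
  proof
    fix a assume a: "a \<in> A"
    obtain z where "z \<in> S" "a = ((a \<cdot> z) \<cdot> a) \<cdot> a"
      using intra_regular_iterated_factor[OF e ir, of a] a AS by blast
    then show "a \<in> set_prod (\<cdot>) A A"
      using bi[of a z a] a unfolding set_prod_def by blast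
  qed
qed

end

section \<open>The characterization\<close>

theorem theorem8:
  fixes S A :: "'a set" and m :: "'a \<Rightarrow> 'a \<Rightarrow> 'a"
  assumes "la_semigroup S m"
    and "\<exists>e. left_identity S m e"
    and "intra_regular S m"
    and "A \<noteq> {}" and "A \<subseteq> S"
  shows "(bi_ideal S m A \<longleftrightarrow>
            set_prod m (set_prod m A S) A = A \<and> set_prod m A A = A) \<and>
         (generalized_bi_ideal S m A \<longleftrightarrow>
            set_prod m (set_prod m A S) A = A \<and> set_prod m A A = A)"
proof -
  interpret la_semigroup S m
    by fact
  obtain e where e: "left_identity S m e"
    using assms(2) by blast
  let ?fixed = "set_prod m (set_prod m A S) A = A \<and> set_prod m A A = A"
  have "?fixed" if gen: "generalized_bi_ideal S m A"
    using subset_bi_product[OF e assms(3,5)] generalized_bi_ideal_idempotent[OF e assms(3) gen]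
      gen unfolding generalized_bi_ideal_def by blast
  moreover have "generalized_bi_ideal S m A" if "bi_ideal S m A"
    using that by (simp add: bi_ideal_def la_subsemigroup_def generalized_bi_ideal_def)
  moreover have "bi_ideal S m A" if "?fixed"
    using that assms(4,5) by (simp add: bi_ideal_def la_subsemigroup_def)
  ultimately show ?thesis
    by blast
qed

end
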